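(* Let $d\ge 2$ and let $H\subset\mathbb{R}^d$ be an axis-parallel hypercuboid (box) tiled by $n$ axis-parallel hypercubes. Then there is a positive real $\lambda$ such that, after scaling the whole configuration by $\lambda$, the shortest side of the scaled hypercuboid has length at most $4^{\frac{2(n-1)}{d}+1}$, its longest side has length at most $n\cdot 4^{\frac{2(n-1)}{d}+1}$, and all tiling hypercubes have integer side lengths.
   Context: A tiling of a region by tiles means a finite family of closed tiles with pairwise disjoint interiors whose union is the region. *)

theory Defs
  imports "HOL-Analysis.Analysis"
begin

definition is_hypercuboid :: "(real ^ 'd) set \<Rightarrow> bool" where
  "is_hypercuboid H \<longleftrightarrow> (\<exists>a b. (\<forall>i. a $ i < b $ i) \<and> H = cbox a b)"

definition is_hypercube :: "(real ^ 'd) set \<Rightarrow> bool" where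
  "is_hypercube Q \<longleftrightarrow> (\<exists>a s. 0 < s \<and> Q = cbox a (\<chi> i. a $ i + s))"

text \<open>The family of tiles is a plain set: two equal tiles with nonempty interior cannot have
  disjoint interiors, so for hypercubes the cardinality of the set is the number of tiles.\<close>

definition is_tiling :: "(real ^ 'd) set set \<Rightarrow> (real ^ 'd) set \<Rightarrow> bool" where
  "is_tiling T R \<longleftrightarrow> finite T \<and> (\<forall>Q\<in>T. closed Q) \<and>
     pairwise (\<lambda>P Q. interior P \<inter> interior Q = {}) T \<and> \<Union>T = R"

text \<open>Intended for nonempty boxes only.\<close>

definition side_length :: "(real ^ 'd) set \<Rightarrow> 'd \<Rightarrow> real" where
  "side_length X i = interval_upperbound X $ i - interval_lowerbound X $ i"

lemma side_length_cbox:
  fixes a b :: "real ^ 'd"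
  assumes "\<And>i. a $ i \<le> b $ i"
  shows "side_length (cbox a b) i = b $ i - a $ i"
proof -
  have "cbox a b \<noteq> {}"
    using assms by (auto simp: interval_ne_empty_cart)
  then show ?thesis
    by (simp add: side_length_def interval_bounds')
qed

definition shortest_side :: "(real ^ 'd) set \<Rightarrow> real" where
  "shortest_side X = Min (range (side_length X))"

definition longest_side :: "(real ^ 'd) set \<Rightarrow> real" where
  "longest_side X = Max (range (side_length X))"

definition scaled :: "real \<Rightarrow> (real ^ 'd) set \<Rightarrow> (real ^ 'd) set" where
  "scaled r X = (\<lambda>x. r *\<^sub>R x) ` X"

end

theory Submission
  imports Defs
begin

text \<open>Reassign the heights of the facet hyperplanes perpendicular to direction i and let w be the
  resulting changes of height across the cubes. Since products of differences are additive over
  the tiling, the vectors w, w' of two distinct directions satisfy: the sum over the cubes of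
  s^(d-2) w w', where s is the side length, only depends on the total height changes of the box.
  Hence the vectors of total change 0 are pairwise orthogonal across directions and orthogonal
  to s, so by counting dimensions the numbers of inner hyperplanes, summed over all directions,
  are at most n - 1. Two directions p, q therefore have at most 2(n-1)/d inner hyperplanes
  together.

  Take the heights in directions p and q as unknowns, the lowest ones being 0, with one equation
  per cube stating that its extents in the two directions agree. By the same orthogonality the
  actual heights are the only solution up to scaling. Each equation has l1-norm at most 4, so
  Siegel's pigeonhole argument yields a nonzero integer solution with entries at most
  4^(2(n-1)/d + 1).\<close>

section \<open>Small integer solutions of linear equations\<close>

text \<open>Gaussian elimination on the coordinates: a vector with nonzero entry at the new
  coordinate is the pivot and clears that coordinate in all others.\<close>

lemma nontrivial_linear_relation:
  fixes u :: "'k \<Rightarrow> 'j \<Rightarrow> 'a::field"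
  assumes "finite J" "finite K" "card J < card K"
  shows "\<exists>c. (\<exists>k\<in>K. c k \<noteq> 0) \<and> (\<forall>j\<in>J. (\<Sum>k\<in>K. c k * u k j) = 0)"
  using assms
proof (induction J arbitrary: K u rule: finite_induct)
  case empty
  then obtain k where "k \<in> K"
    by fastforce
  then show ?case
    by (intro exI[of _ "\<lambda>_. 1"]) auto
next
  case (insert j J)
  show ?case
  proof (cases "\<forall>k\<in>K. u k j = 0")
    case True
    have "card J < card K"
      using insert by simp
    from insert.IH[OF insert.prems(1) this, of u] True show ?thesis
      by auto
  next
    case False
    then obtain k where k: "k \<in> K" "u k j \<noteq> 0"
      by blast
    define K' where "K' = K - {k}"
    have K: "K = insert k K'" "k \<notin> K'" "finite K'"
      using k insert.prems by (auto simp: K'_def)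
    have "card J < card K'"
      using insert K by simp
    from insert.IH[OF K(3) this, of "\<lambda>k' i. u k' i - u k' j / u k j * u k i"]
    obtain c where c: "\<exists>k\<in>K'. c k \<noteq> 0"
      "\<And>i. i \<in> J \<Longrightarrow> (\<Sum>k'\<in>K'. c k' * (u k' i - u k' j / u k j * u k i)) = 0"
      by blast
    \<comment> \<open>The pivot's coefficient absorbs the multiples subtracted from the others; the
      reduced vectors vanish at \<open>j\<close>, so the relation holds there as well.\<close>
    define c' where "c' = c(k := - (\<Sum>k'\<in>K'. c k' * u k' j) / u k j)"
    have c': "(\<Sum>k'\<in>K. c' k' * u k' i) = (\<Sum>k'\<in>K'. c k' * (u k' i - u k' j / u k j * u k i))" for i
    proof -
      have "(\<Sum>k'\<in>K'. c' k' * u k' i) = (\<Sum>k'\<in>K'. c k' * u k' i)"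
        using K by (intro sum.cong) (auto simp: c'_def)
      then show ?thesis
        using K by (simp add: c'_def right_diff_distrib sum_subtractf sum_divide_distrib
            sum_distrib_right mult.assoc)
    qed
    have "\<forall>i\<in>insert j J. (\<Sum>k'\<in>K. c' k' * u k' i) = 0"
      using c(2) k unfolding c' by auto
    moreover have "\<exists>k\<in>K. c' k \<noteq> 0"
      using c(1) K by (auto simp: c'_def)
    ultimately show ?thesis
      by blast
  qed
qed

lemma kernel_of_few_rows:
  fixes A :: "'r \<Rightarrow> 'i \<Rightarrow> 'a::field" and x :: "'i \<Rightarrow> 'a"
  assumes "finite R" "finite I" "k \<in> I" "x k \<noteq> 0"
    and "\<And>r. r \<in> R \<Longrightarrow> (\<Sum>i\<in>I. A r i * x i) = 0"
  shows "\<exists>S\<subseteq>R. card S < card I \<and>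
    (\<forall>z. (\<forall>r\<in>S. (\<Sum>i\<in>I. A r i * z i) = 0) \<longrightarrow> (\<forall>r\<in>R. (\<Sum>i\<in>I. A r i * z i) = 0))"
  using assms(1,5)
proof (induction R rule: finite_psubset_induct)
  case (psubset R)
  show ?case
  proof (cases "card R < card I")
    case True
    then show ?thesis
      by blast
  next
    case False
    \<comment> \<open>Column \<open>k\<close> is left out, so \<open>card I\<close> rows already
      have a nontrivial relation on the remaining columns.\<close>
    have "card (I - {k}) < card R"
      using False assms(2,3) card_Diff1_less by fastforce
    from nontrivial_linear_relation[OF _ psubset.hyps(1) this, of A] assms(2)
    obtain c r0 where c: "r0 \<in> R" "c r0 \<noteq> 0"
      "\<And>i. i \<in> I - {k} \<Longrightarrow> (\<Sum>r\<in>R. c r * A r i) = 0"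
      by auto
    have swap: "(\<Sum>r\<in>R. c r * (\<Sum>i\<in>I. A r i * z i)) = (\<Sum>i\<in>I. (\<Sum>r\<in>R. c r * A r i) * z i)" for z
      unfolding sum_distrib_left sum_distrib_right
      by (subst sum.swap) (simp add: mult.assoc)
    \<comment> \<open>The kernel vector transports the relation from the columns other than k to column k.\<close>
    have "(\<Sum>i\<in>I. (\<Sum>r\<in>R. c r * A r i) * x i) = 0"
      unfolding swap[symmetric] using psubset.prems by simp
    moreover have "(\<Sum>i\<in>I. (\<Sum>r\<in>R. c r * A r i) * x i) = (\<Sum>r\<in>R. c r * A r k) * x k"
      using c(3) assms(2,3) by (subst sum.remove[of _ k]) auto
    ultimately have ck: "(\<Sum>r\<in>R. c r * A r i) = 0" if "i \<in> I" for i
      using c(3) assms(4) that by (cases "i = k") auto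
    have red: "(\<Sum>i\<in>I. A r0 i * z i) = 0"
      if "\<forall>r\<in>R - {r0}. (\<Sum>i\<in>I. A r i * z i) = 0" for z
    proof -
      have "(\<Sum>r\<in>R. c r * (\<Sum>i\<in>I. A r i * z i)) = c r0 * (\<Sum>i\<in>I. A r0 i * z i)"
        using that c(1) psubset.hyps(1) by (subst sum.remove[of _ r0]) auto
      then show ?thesis
        using c(2) ck by (simp add: swap)
    qed
    have "R - {r0} \<subset> R"
      using c(1) by blast
    from psubset.IH[OF this] psubset.prems obtain S where S: "S \<subseteq> R - {r0}" "card S < card I"
      "\<And>z. (\<forall>r\<in>S. (\<Sum>i\<in>I. A r i * z i) = 0) \<Longrightarrow> (\<forall>r\<in>R - {r0}. (\<Sum>i\<in>I. A r i * z i) = 0)"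
      by auto
    show ?thesis
    proof (intro exI[of _ S] conjI allI impI ballI)
      fix z r
      assume "\<forall>r\<in>S. (\<Sum>i\<in>I. A r i * z i) = 0" and "r \<in> R"
      with S(3)[of z] red[of z] show "(\<Sum>i\<in>I. A r i * z i) = 0"
        by (cases "r = r0") auto
    qed (use S in auto)
  qed
qed

text \<open>Pigeonhole: the vectors with entries in \<open>{0..B}\<close> outnumber their possible
  images, so two share an image and their difference is a small kernel vector.\<close>

lemma siegel_small_kernel_vector:
  fixes A :: "'r \<Rightarrow> 'i \<Rightarrow> int" and M :: nat
  assumes fin: "finite R" "finite I" and card: "card R < card I" and "M \<ge> 1"
    and norm: "\<And>r. r \<in> R \<Longrightarrow> (\<Sum>i\<in>I. \<bar>A r i\<bar>) \<le> int M"
  shows "\<exists>z. (\<exists>i\<in>I. z i \<noteq> 0) \<and> (\<forall>i\<in>I. \<bar>z i\<bar> \<le> int (M ^ card R)) \<and>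
    (\<forall>r\<in>R. (\<Sum>i\<in>I. A r i * z i) = 0)"
proof -
  \<comment> \<open>With \<open>r = card R\<close>, this choice gives \<open>(M * B + 1) ^ r \<le>
    (M * (B + 1)) ^ r = B * (B + 1) ^ r < (B + 1) ^ Suc r\<close>.\<close>
  define B where "B = M ^ card R"
  define D where "D = PiE I (\<lambda>_. {0..int B})"
  \<comment> \<open>Negative and positive coefficients are bounded separately, so the range of a row
    has width its l1-norm times \<open>B\<close>, without a factor 2.\<close>
  define lo where "lo r = (\<Sum>i\<in>I. min (A r i) 0) * int B" for r
  define hi where "hi r = (\<Sum>i\<in>I. max (A r i) 0) * int B" for r
  define \<phi> where "\<phi> z = restrict (\<lambda>r. \<Sum>i\<in>I. A r i * z i) R" for z
  have width: "hi r - lo r \<le> int (M * B)" if "r \<in> R" for r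
  proof -
    have "hi r - lo r = (\<Sum>i\<in>I. max (A r i) 0 - min (A r i) 0) * int B"
      by (simp add: hi_def lo_def sum_subtractf left_diff_distrib)
    also have "(\<Sum>i\<in>I. max (A r i) 0 - min (A r i) 0) = (\<Sum>i\<in>I. \<bar>A r i\<bar>)"
      by (intro sum.cong) auto
    also have "\<dots> * int B \<le> int M * int B"
      using norm[OF that] by (intro mult_right_mono) auto
    finally show ?thesis
      by simp
  qed
  have "\<phi> z \<in> PiE R (\<lambda>r. {lo r..hi r})" if z: "z \<in> D" for z
  proof -
    have zi: "0 \<le> z i" "z i \<le> int B" if "i \<in> I" for i
      using z that by (auto simp: D_def PiE_def Pi_def)
    have "lo r \<le> (\<Sum>i\<in>I. A r i * z i)" for r
      unfolding lo_def sum_distrib_right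
    proof (intro sum_mono)
      fix i assume "i \<in> I"
      have "min (A r i) 0 * int B \<le> min (A r i) 0 * z i"
        using zi[OF \<open>i \<in> I\<close>] by (intro mult_left_mono_neg) auto
      also have "\<dots> \<le> A r i * z i"
        using zi[OF \<open>i \<in> I\<close>] by (intro mult_right_mono) auto
      finally show "min (A r i) 0 * int B \<le> A r i * z i" .
    qed
    moreover have "(\<Sum>i\<in>I. A r i * z i) \<le> hi r" for r
      unfolding hi_def sum_distrib_right
      using zi by (intro sum_mono mult_mono) auto
    ultimately show ?thesis
      by (auto simp: \<phi>_def)
  qed
  then have "card (\<phi> ` D) \<le> card (PiE R (\<lambda>r. {lo r..hi r}))"
    using fin by (intro card_mono finite_PiE) auto
  also have "\<dots> = (\<Prod>r\<in>R. card {lo r..hi r})"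
    using fin by (simp add: card_PiE)
  also have "\<dots> \<le> (\<Prod>r\<in>R. M * B + 1)"
    using width by (intro prod_mono) (force simp: nat_le_iff)
  also have "\<dots> = (M * B + 1) ^ card R"
    by simp
  also have "\<dots> \<le> (M * (B + 1)) ^ card R"
    using \<open>M \<ge> 1\<close> by (intro power_mono) auto
  also have "\<dots> = B * (B + 1) ^ card R"
    unfolding power_mult_distrib B_def ..
  also have "\<dots> < (B + 1) ^ Suc (card R)"
    by simp
  also have "\<dots> \<le> (B + 1) ^ card I"
    using card by (intro power_increasing) auto
  also have "\<dots> = card D"
    using fin by (simp add: D_def card_PiE nat_add_distrib)
  finally have "\<not> inj_on \<phi> D"
    by (rule pigeonhole)
  then obtain z1 z2 where z: "z1 \<in> D" "z2 \<in> D" "\<phi> z1 = \<phi> z2" "z1 \<noteq> z2"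
    by (auto simp: inj_on_def)
  have "\<exists>i\<in>I. z1 i \<noteq> z2 i"
    using z PiE_ext unfolding D_def by metis
  moreover have "\<bar>z1 i - z2 i\<bar> \<le> int B" if "i \<in> I" for i
    using z(1,2) that by (force simp: D_def PiE_def Pi_def)
  moreover have "(\<Sum>i\<in>I. A r i * (z1 i - z2 i)) = 0" if "r \<in> R" for r
    using fun_cong[OF z(3), of r] that by (simp add: \<phi>_def right_diff_distrib sum_subtractf)
  ultimately show ?thesis
    unfolding B_def by (intro exI[of _ "\<lambda>i. z1 i - z2 i"]) auto
qed

text \<open>The real solution \<open>x\<close> cuts the rows down to fewer than
  \<open>card I\<close>; Siegel's bound then depends on \<open>M\<close> and the number of unknowns,
  not on the number of rows.\<close>

lemma small_integer_kernel_vector: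
  fixes A :: "'r \<Rightarrow> 'i \<Rightarrow> int" and M :: nat and x :: "'i \<Rightarrow> real"
  assumes fin: "finite R" "finite I" and "M \<ge> 1"
    and norm: "\<And>r. r \<in> R \<Longrightarrow> (\<Sum>i\<in>I. \<bar>A r i\<bar>) \<le> int M"
    and x: "k \<in> I" "x k \<noteq> 0" "\<And>r. r \<in> R \<Longrightarrow> (\<Sum>i\<in>I. A r i * x i) = 0"
  shows "\<exists>z. (\<exists>i\<in>I. z i \<noteq> 0) \<and> (\<forall>i\<in>I. \<bar>z i\<bar> \<le> int (M ^ (card I - 1))) \<and>
    (\<forall>r\<in>R. (\<Sum>i\<in>I. A r i * z i) = 0)"
proof -
  from kernel_of_few_rows[of R I k x "\<lambda>r i. real_of_int (A r i)", OF fin x]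
  obtain S where S: "S \<subseteq> R" "card S < card I"
    and ker: "\<And>z r. \<lbrakk>\<forall>r\<in>S. (\<Sum>i\<in>I. real_of_int (A r i) * z i) = 0; r \<in> R\<rbrakk> \<Longrightarrow>
      (\<Sum>i\<in>I. real_of_int (A r i) * z i) = 0"
    by blast
  have "finite S"
    using S(1) fin(1) finite_subset by blast
  moreover have "(\<Sum>i\<in>I. \<bar>A r i\<bar>) \<le> int M" if "r \<in> S" for r
    using norm S(1) that by blast
  ultimately obtain z where z: "\<exists>i\<in>I. z i \<noteq> 0" "\<forall>i\<in>I. \<bar>z i\<bar> \<le> int (M ^ card S)"
    "\<forall>r\<in>S. (\<Sum>i\<in>I. A r i * z i) = 0"
    using siegel_small_kernel_vector[OF _ fin(2) S(2) \<open>M \<ge> 1\<close>, of A] by auto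
  have int: "(\<Sum>i\<in>I. real_of_int (A r i) * real_of_int (z i)) = real_of_int (\<Sum>i\<in>I. A r i * z i)" for r
    by simp
  have "\<forall>r\<in>S. (\<Sum>i\<in>I. real_of_int (A r i) * real_of_int (z i)) = 0"
    using z(3) unfolding int by simp
  from ker[OF this] have "\<forall>r\<in>R. (\<Sum>i\<in>I. A r i * z i) = 0"
    unfolding int of_int_eq_0_iff by blast
  moreover have "M ^ card S \<le> M ^ (card I - 1)"
    using S(2) \<open>M \<ge> 1\<close> by (intro power_increasing) auto
  ultimately show ?thesis
    using z(1,2) by (intro exI[of _ z]) (meson of_nat_mono order_trans)
qed

text \<open>A discrete fundamental theorem: the weight of a point is the jump of \<open>f\<close> to
  the next point of \<open>C\<close>.\<close>

lemma telescoping_weights: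
  fixes f :: "'a::linorder \<Rightarrow> 'b::ab_group_add"
  assumes "finite C"
  shows "\<exists>g. \<forall>x\<in>C. \<forall>y\<in>C. x \<le> y \<longrightarrow> f y - f x = sum g {v \<in> C. x \<le> v \<and> v < y}"
  using assms
proof (induction C rule: finite_linorder_max_induct)
  case empty
  then show ?case
    by simp
next
  case (insert b C)
  then obtain g where g: "\<And>x y. \<lbrakk>x \<in> C; y \<in> C; x \<le> y\<rbrakk> \<Longrightarrow>
      f y - f x = sum g {v \<in> C. x \<le> v \<and> v < y}"
    by blast
  \<comment> \<open>Adding a new maximum \<open>b\<close> creates one gap, starting at the old
    maximum \<open>m\<close>; sums ending at or below \<open>m\<close> do not contain its
    weight.\<close>
  define m where "m = Max C"
  define g' where "g' = g(m := f b - f m)"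
  have eq: "f y - f x = sum g' {v \<in> insert b C. x \<le> v \<and> v < y}"
    if "x \<in> C" "y \<in> C" "x \<le> y" for x y
  proof -
    have "y \<le> m" "y < b"
      using that insert by (auto simp: m_def)
    then have "sum g' {v \<in> insert b C. x \<le> v \<and> v < y} = sum g {v \<in> C. x \<le> v \<and> v < y}"
      by (intro sum.cong) (auto simp: g'_def)
    then show ?thesis
      using g that by simp
  qed
  have eqb: "f b - f x = sum g' {v \<in> insert b C. x \<le> v \<and> v < b}" if "x \<in> C" for x
  proof -
    have m: "m \<in> C" "x \<le> m" "\<And>v. v \<in> C \<Longrightarrow> v \<le> m"
      using that insert.hyps(1) by (auto simp: m_def intro!: Max_in)
    have "{v \<in> insert b C. x \<le> v \<and> v < b} = insert m {v \<in> insert b C. x \<le> v \<and> v < m}"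
      using m insert.hyps by force
    then have "sum g' {v \<in> insert b C. x \<le> v \<and> v < b} =
        g' m + sum g' {v \<in> insert b C. x \<le> v \<and> v < m}"
      using insert.hyps(1) by simp
    moreover have "g' m = f b - f m"
      by (simp add: g'_def)
    ultimately show ?thesis
      using eq[OF that m(1,2)] by (simp add: algebra_simps)
  qed
  show ?case
  proof (intro exI[of _ g'] ballI impI)
    fix x y
    assume xy: "x \<in> insert b C" "y \<in> insert b C" "x \<le> y"
    consider "x = y" | "x \<in> C" "y \<in> C" | "x \<in> C" "y = b"
      using xy insert.hyps by force
    then show "f y - f x = sum g' {v \<in> insert b C. x \<le> v \<and> v < y}"
    proof cases
      case 1
      then have no: "{v \<in> insert b C. x \<le> v \<and> v < y} = {}"
        by auto
      show ?thesis
        unfolding no using 1 by simp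
    next
      case 2
      then show ?thesis
        using eq xy by blast
    next
      case 3
      then show ?thesis
        using eqb by blast
    qed
  qed
qed

section \<open>Box tilings by cubes\<close>

text \<open>Tiles are treated as half-open cubes: then \<open>cover\<close> states an exact
  partition of the half-open box, with no exceptions on common faces.\<close>

locale cube_tiling =
  fixes a b :: "'d::finite \<Rightarrow> real" and T :: "'t set" and l :: "'t \<Rightarrow> 'd \<Rightarrow> real"
    and s :: "'t \<Rightarrow> real"
  assumes finite_T: "finite T"
    and box: "a i < b i"
    and s_pos: "Q \<in> T \<Longrightarrow> s Q > 0"
    and lower: "Q \<in> T \<Longrightarrow> a i \<le> l Q i"
    and upper: "Q \<in> T \<Longrightarrow> l Q i + s Q \<le> b i"
    and cover: "(\<And>i. a i \<le> c i \<and> c i < b i) \<Longrightarrow>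
      \<exists>!Q. Q \<in> T \<and> (\<forall>i. l Q i \<le> c i \<and> c i < l Q i + s Q)"
begin

section \<open>Heights of facet hyperplanes and additivity of products\<close>

definition coords :: "'d \<Rightarrow> real set" where
  "coords i = {a i, b i} \<union> (\<lambda>Q. l Q i) ` T \<union> (\<lambda>Q. l Q i + s Q) ` T"

text \<open>\<open>f\<close> reassigns the heights in direction \<open>i\<close>; as
  \<open>Q\<close> varies over \<open>T\<close> this is the vector \<open>w\<close> of height
  changes.\<close>

definition incr :: "(real \<Rightarrow> real) \<Rightarrow> 'd \<Rightarrow> 't \<Rightarrow> real" where
  "incr f i Q = f (l Q i + s Q) - f (l Q i)"

lemma finite_coords [simp]: "finite (coords i)"
  using finite_T by (simp add: coords_def)

lemma coords_I: "a i \<in> coords i" "b i \<in> coords i"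
  "Q \<in> T \<Longrightarrow> l Q i \<in> coords i" "Q \<in> T \<Longrightarrow> l Q i + s Q \<in> coords i"
  by (auto simp: coords_def)

text \<open>All facet hyperplanes together cut the box into grid cells. Each product of increments
  is a sum of cell weights, and the cells of the box are split among the tiles.\<close>

lemma sum_prod_incr:
  "(\<Sum>Q\<in>T. \<Prod>i\<in>UNIV. incr (F i) i Q) = (\<Prod>i\<in>UNIV. F i (b i) - F i (a i))"
proof -
  have "\<forall>i. \<exists>\<omega>. \<forall>x\<in>coords i. \<forall>y\<in>coords i. x \<le> y \<longrightarrow>
      F i y - F i x = sum \<omega> {v \<in> coords i. x \<le> v \<and> v < y}"
    by (rule allI, rule telescoping_weights) simp
  from choice[OF this] obtain \<omega> where \<omega>: "\<And>i x y. \<lbrakk>x \<in> coords i; y \<in> coords i; x \<le> y\<rbrakk> \<Longrightarrow>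
      F i y - F i x = sum (\<omega> i) {v \<in> coords i. x \<le> v \<and> v < y}"
    by blast
  \<comment> \<open>A grid cell is represented by its lower corner, which lies in a half-open cube
    of the tiling exactly when the whole cell does.\<close>
  define cells where "cells x y = PiE UNIV (\<lambda>i. {v \<in> coords i. x i \<le> v \<and> v < y i})"
    for x y :: "'d \<Rightarrow> real"
  have fin: "finite (cells x y)" for x y
    unfolding cells_def by (intro finite_PiE) auto
  have prod: "(\<Prod>i\<in>UNIV. F i (y i) - F i (x i)) = (\<Sum>c\<in>cells x y. \<Prod>i\<in>UNIV. \<omega> i (c i))"
    if "\<And>i. x i \<in> coords i" "\<And>i. y i \<in> coords i" "\<And>i. x i \<le> y i" for x y
    unfolding cells_def by (subst prod_sum_PiE[symmetric]) (auto simp: \<omega> that)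
  define top where "top Q i = l Q i + s Q" for Q i
  have disj: "cells (l P) (top P) \<inter> cells (l Q) (top Q) = {}"
    if "P \<in> T" "Q \<in> T" "P \<noteq> Q" for P Q
  proof (rule ccontr)
    assume "cells (l P) (top P) \<inter> cells (l Q) (top Q) \<noteq> {}"
    then obtain c where c: "\<And>i. l P i \<le> c i \<and> c i < l P i + s P"
      "\<And>i. l Q i \<le> c i \<and> c i < l Q i + s Q"
      by (auto simp: cells_def top_def PiE_def Pi_def)
    have "\<exists>!Q. Q \<in> T \<and> (\<forall>i. l Q i \<le> c i \<and> c i < l Q i + s Q)"
      using c lower[OF \<open>P \<in> T\<close>] upper[OF \<open>P \<in> T\<close>]
      by (intro cover) (meson order_trans less_le_trans)
    then show False
      using c that by blast
  qed
  have "cells a b = (\<Union>Q\<in>T. cells (l Q) (top Q))"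
  proof (intro equalityI subsetI)
    fix c assume c: "c \<in> cells a b"
    then have "\<exists>!Q. Q \<in> T \<and> (\<forall>i. l Q i \<le> c i \<and> c i < l Q i + s Q)"
      by (intro cover) (auto simp: cells_def PiE_def Pi_def)
    then show "c \<in> (\<Union>Q\<in>T. cells (l Q) (top Q))"
      using c by (auto simp: cells_def top_def PiE_def Pi_def)
  next
    fix c assume "c \<in> (\<Union>Q\<in>T. cells (l Q) (top Q))"
    then obtain Q where Q: "Q \<in> T" "c \<in> cells (l Q) (top Q)"
      by blast
    then show "c \<in> cells a b"
      using lower[OF Q(1)] upper[OF Q(1)]
      unfolding cells_def top_def PiE_def Pi_def by (auto intro: order_trans less_le_trans)
  qed
  then have "(\<Prod>i\<in>UNIV. F i (b i) - F i (a i)) =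
      (\<Sum>c\<in>(\<Union>Q\<in>T. cells (l Q) (top Q)). \<Prod>i\<in>UNIV. \<omega> i (c i))"
    using box by (subst prod) (auto simp: coords_I less_imp_le)
  also have "\<dots> = (\<Sum>Q\<in>T. \<Sum>c\<in>cells (l Q) (top Q). \<Prod>i\<in>UNIV. \<omega> i (c i))"
    using finite_T fin disj by (intro sum.UNION_disjoint) auto
  also have "\<dots> = (\<Sum>Q\<in>T. \<Prod>i\<in>UNIV. incr (F i) i Q)"
  proof (intro sum.cong refl)
    fix Q assume Q: "Q \<in> T"
    show "(\<Sum>c\<in>cells (l Q) (top Q). \<Prod>i\<in>UNIV. \<omega> i (c i)) = (\<Prod>i\<in>UNIV. incr (F i) i Q)"
      using Q s_pos[OF Q] by (subst prod[symmetric]) (auto simp: coords_I top_def incr_def)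
  qed
  finally show ?thesis ..
qed

section \<open>Linear and bilinear identities for increments\<close>

lemma incr_id [simp]: "incr (\<lambda>x. x) i Q = s Q"
  by (simp add: incr_def)

text \<open>All directions but \<open>i\<close> keep their heights, and each contributes a factor
  \<open>s Q\<close>. For the identity in direction \<open>i\<close> this is the volume
  formula.\<close>

lemma sum_incr:
  "(\<Sum>Q\<in>T. s Q ^ (CARD('d) - 1) * incr f i Q) = (f (b i) - f (a i)) * (\<Prod>k\<in>UNIV - {i}. b k - a k)"
proof -
  define F where "F k = (if k = i then f else (\<lambda>x. x))" for k
  have split: "(\<Prod>k\<in>UNIV. h k) = h i * (\<Prod>k\<in>UNIV - {i}. h k)" for h :: "'d \<Rightarrow> real"
    by (rule prod.remove) auto
  have "(\<Prod>k\<in>UNIV. incr (F k) k Q) = s Q ^ (CARD('d) - 1) * incr f i Q" for Q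
    by (simp add: split F_def)
  moreover have "(\<Prod>k\<in>UNIV. F k (b k) - F k (a k)) =
      (f (b i) - f (a i)) * (\<Prod>k\<in>UNIV - {i}. b k - a k)"
    by (simp add: split F_def)
  ultimately show ?thesis
    using sum_prod_incr[of F] by simp
qed

lemma sum_incr_mult_incr:
  assumes "i \<noteq> j"
  shows "(\<Sum>Q\<in>T. s Q ^ (CARD('d) - 2) * (incr f i Q * incr g j Q)) =
    (f (b i) - f (a i)) * (g (b j) - g (a j)) * (\<Prod>k\<in>UNIV - {i} - {j}. b k - a k)"
proof -
  define F where "F k = (if k = i then f else if k = j then g else (\<lambda>x. x))" for k
  have split: "(\<Prod>k\<in>UNIV. h k) = h i * (h j * (\<Prod>k\<in>UNIV - {i} - {j}. h k))" for h :: "'d \<Rightarrow> real"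
    using assms by (simp add: prod.remove[of UNIV i] prod.remove[of "UNIV - {i}" j])
  have "card (UNIV - {i} - {j}) = CARD('d) - 2"
    using assms by simp
  then have "(\<Prod>k\<in>UNIV. incr (F k) k Q) = s Q ^ (CARD('d) - 2) * (incr f i Q * incr g j Q)" for Q
    using assms by (simp add: split F_def)
  moreover have "(\<Prod>k\<in>UNIV. F k (b k) - F k (a k)) =
      (f (b i) - f (a i)) * (g (b j) - g (a j)) * (\<Prod>k\<in>UNIV - {i} - {j}. b k - a k)"
    using assms by (simp add: split F_def)
  ultimately show ?thesis
    using sum_prod_incr[of F] by simp
qed

lemma orthogonal_incr:
  assumes "i \<noteq> j" "f (b i) = f (a i)"
  shows "(\<Sum>Q\<in>T. s Q ^ (CARD('d) - 2) * (incr f i Q * incr g j Q)) = 0"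
  using assms by (simp add: sum_incr_mult_incr)

section \<open>Height functions with vanishing increments\<close>

lemma weighted_square_eq_0:
  assumes "(\<Sum>Q\<in>T. s Q ^ k * (u Q)\<^sup>2) = 0" "Q \<in> T"
  shows "u Q = 0"
proof -
  have "s Q ^ k * (u Q)\<^sup>2 = 0"
    using assms finite_T s_pos by (subst (asm) sum_nonneg_eq_0_iff) (auto simp: less_imp_le)
  then show ?thesis
    using s_pos[OF assms(2)] by simp
qed

text \<open>Test with the indicator \<open>f\<close> of \<open>v\<close>: were \<open>v\<close> no
  upper end, all increments would be at most 0, but their weighted sum is a nonnegative total. Hence
  all vanish, although a cube starting at \<open>v\<close> has increment -1.\<close>

lemma coord_is_top:
  assumes "v \<in> coords i" "v \<noteq> a i"
  shows "\<exists>Q\<in>T. l Q i + s Q = v"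
proof (rule ccontr)
  assume no: "\<not> ?thesis"
  define f where "f x = (if x = v then 1 else 0 :: real)" for x
  have incr: "incr f i Q = - f (l Q i)" if "Q \<in> T" for Q
    using no that by (auto simp: f_def incr_def)
  have nonpos: "s Q ^ (CARD('d) - 1) * incr f i Q \<le> 0" if "Q \<in> T" for Q
    using s_pos[OF that] incr[OF that] by (auto simp: f_def)
  have pos: "(\<Prod>k\<in>UNIV - {i}. b k - a k) > 0"
    using box by (intro prod_pos) auto
  have sum: "(\<Sum>Q\<in>T. s Q ^ (CARD('d) - 1) * incr f i Q) =
      f (b i) * (\<Prod>k\<in>UNIV - {i}. b k - a k)"
    using assms by (subst sum_incr) (auto simp: f_def)
  \<comment> \<open>For \<open>v = b i\<close> the weighted sum would be positive, so
    \<open>v\<close> can only be the lower end of some cube.\<close>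
  have "(\<Sum>Q\<in>T. s Q ^ (CARD('d) - 1) * incr f i Q) \<le> 0"
    using nonpos by (intro sum_nonpos) auto
  then have "v \<noteq> b i"
    using pos unfolding sum by (auto simp: f_def)
  then obtain Q where Q: "Q \<in> T" "v = l Q i"
    using assms no by (auto simp: coords_def)
  have "(\<Sum>Q\<in>T. s Q ^ (CARD('d) - 1) * incr f i Q) = 0"
    using \<open>v \<noteq> b i\<close> sum by (simp add: f_def)
  then have "(\<Sum>Q\<in>T. - (s Q ^ (CARD('d) - 1) * incr f i Q)) = 0"
    by (simp add: sum_negf)
  then have "s Q ^ (CARD('d) - 1) * incr f i Q = 0"
    using nonpos Q(1) finite_T by (subst (asm) sum_nonneg_eq_0_iff) auto
  then show False
    using s_pos[OF Q(1)] incr[OF Q(1)] Q(2) by (simp add: f_def)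
qed

text \<open>At the least coordinate where \<open>f\<close> differs from \<open>f (a i)\<close> some
  cube ends, and it starts at a smaller coordinate where \<open>f\<close> still agrees.\<close>

lemma incr_eq_0_imp_const:
  assumes "\<And>Q. Q \<in> T \<Longrightarrow> incr f i Q = 0" "v \<in> coords i"
  shows "f v = f (a i)"
proof (rule ccontr)
  assume neq: "f v \<noteq> f (a i)"
  define X where "X = {v \<in> coords i. f v \<noteq> f (a i)}"
  have X: "finite X" "X \<noteq> {}"
    using assms(2) neq by (auto simp: X_def)
  define w where "w = Min X"
  have w: "w \<in> X" "\<And>x. x < w \<Longrightarrow> x \<notin> X"
    using X by (auto simp: w_def dest: Min_le)
  then have "w \<in> coords i" "w \<noteq> a i"
    by (auto simp: X_def)
  from coord_is_top[OF this] obtain Q where Q: "Q \<in> T" "l Q i + s Q = w"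
    by blast
  then have "l Q i \<notin> X"
    using w(2) s_pos by force
  then have "f (l Q i) = f (a i)"
    using Q(1) by (auto simp: X_def coords_I)
  moreover have "f w = f (l Q i)"
    using assms(1)[OF Q(1)] Q(2) by (simp add: incr_def)
  ultimately show False
    using w(1) by (simp add: X_def)
qed

section \<open>Counting the inner hyperplanes\<close>

definition inner_coords :: "'d \<Rightarrow> real set" where
  "inner_coords i = coords i - {a i, b i}"

lemma finite_inner_coords [simp]: "finite (inner_coords i)"
  by (simp add: inner_coords_def)

text \<open>The vector \<open>s\<close> together with the increment vectors of the single inner
  hyperplanes is linearly independent in a space of dimension \<open>card T\<close>.\<close>

lemma sum_card_inner_coords_less:
  assumes "CARD('d) \<ge> 2"
  shows "(\<Sum>i\<in>UNIV. card (inner_coords i)) < card T"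
proof (rule ccontr)
  define K where "K = Sigma UNIV inner_coords"
  define step where "step v x = (if x = v then 1 else 0 :: real)" for v x :: real
  \<comment> \<open>\<open>None\<close> stands for \<open>s\<close>; this additional vector yields
    the strict inequality.\<close>
  define u where "u k Q = (case k of None \<Rightarrow> s Q | Some (i, v) \<Rightarrow> incr (step v) i Q)" for k Q
  assume "\<not> ?thesis"
  moreover have finK: "finite K"
    by (simp add: K_def)
  moreover have "card K = (\<Sum>i\<in>UNIV. card (inner_coords i))"
    by (simp add: K_def)
  ultimately have "card T < card (insert None (Some ` K))"
    by (simp add: card_image)
  from nontrivial_linear_relation[OF finite_T _ this, of u] finK
  obtain c where c: "\<exists>k\<in>insert None (Some ` K). c k \<noteq> 0"
    "\<And>Q. Q \<in> T \<Longrightarrow> (\<Sum>k\<in>insert None (Some ` K). c k * u k Q) = 0"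
    by auto
  \<comment> \<open>The coefficients of one direction are combined into a height function that
    vanishes at both ends, so orthogonality applies to it.\<close>
  define f where "f i x = (if x \<in> inner_coords i then c (Some (i, x)) else 0)" for i x
  have f0: "f i (a i) = 0" "f i (b i) = 0" for i
    by (auto simp: f_def inner_coords_def)
  have incr_f: "incr (f i) i Q = (\<Sum>v\<in>inner_coords i. c (Some (i, v)) * incr (step v) i Q)" for i Q
  proof -
    have "f i x = (\<Sum>v\<in>inner_coords i. c (Some (i, v)) * step v x)" for x
      by (simp add: f_def step_def if_distrib sum.delta cong: if_cong)
    then show ?thesis
      by (simp add: incr_def right_diff_distrib sum_subtractf)
  qed
  have rel: "c None * s Q + (\<Sum>i\<in>UNIV. incr (f i) i Q) = 0" if "Q \<in> T" for Q
  proof -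
    have "(\<Sum>i\<in>UNIV. incr (f i) i Q) = (\<Sum>k\<in>K. c (Some k) * u (Some k) Q)"
      unfolding incr_f K_def by (subst sum.Sigma) (auto simp: u_def case_prod_unfold)
    then show ?thesis
      using c(2)[OF that] finK by (simp add: sum.reindex u_def)
  qed
  \<comment> \<open>\<open>s\<close> is the increment vector of the unchanged heights in any other
    direction \<open>j\<close>.\<close>
  have ortho_s: "(\<Sum>Q\<in>T. s Q ^ (CARD('d) - 2) * (incr (f i) i Q * s Q)) = 0" for i
  proof -
    have "card (UNIV - {i}) \<noteq> 0"
      using assms by simp
    then have "UNIV - {i} \<noteq> {}"
      by (metis card.empty)
    then obtain j where "j \<noteq> i"
      by blast
    then show ?thesis
      using orthogonal_incr[of i j "f i" "\<lambda>x. x"] by (simp add: f0)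
  qed
  have incr0: "incr (f i) i Q = 0" if "Q \<in> T" for i Q
  proof (rule weighted_square_eq_0[OF _ that, where u = "incr (f i) i" and k = "CARD('d) - 2"])
    \<comment> \<open>Pairing the relation with the vector of direction \<open>i\<close> removes all
      terms but its own weighted square.\<close>
    have "0 = (\<Sum>Q\<in>T. s Q ^ (CARD('d) - 2) *
        (incr (f i) i Q * (c None * s Q + (\<Sum>j\<in>UNIV. incr (f j) j Q))))"
      using rel by simp
    also have "\<dots> = c None * (\<Sum>Q\<in>T. s Q ^ (CARD('d) - 2) * (incr (f i) i Q * s Q)) +
        (\<Sum>j\<in>UNIV. \<Sum>Q\<in>T. s Q ^ (CARD('d) - 2) * (incr (f i) i Q * incr (f j) j Q))"
      by (subst sum.swap) (simp add: algebra_simps sum.distrib sum_distrib_left)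
    also have "\<dots> = (\<Sum>Q\<in>T. s Q ^ (CARD('d) - 2) * (incr (f i) i Q * incr (f i) i Q))"
      using orthogonal_incr f0
      by (simp add: ortho_s sum.remove[of UNIV i])
    finally show "(\<Sum>Q\<in>T. s Q ^ (CARD('d) - 2) * (incr (f i) i Q)\<^sup>2) = 0"
      by (simp add: power2_eq_square)
  qed
  have "\<exists>Q. Q \<in> T"
    using cover[of a] box by blast
  then have "c None = 0"
    using rel incr0 s_pos by force
  moreover have "c (Some (i, v)) = 0" if "v \<in> inner_coords i" for i v
    using incr_eq_0_imp_const[of "f i" i v] incr0 that f0
    by (auto simp: f_def inner_coords_def split: if_splits)
  ultimately show False
    using c(1) by (auto simp: K_def)
qed

section \<open>Small integer heights in two directions\<close>

text \<open>The exponent is one less than the number of unknown heights. Uniqueness up to scaling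
  turns a small integer solution into a scaling of the tiling.\<close>

lemma integer_scaling_two_directions:
  assumes "p \<noteq> q"
  shows "\<exists>r>0. r * (b p - a p) \<le> 4 ^ (card (inner_coords p) + card (inner_coords q) + 1) \<and>
    (\<forall>Q\<in>T. r * s Q \<in> \<int>)"
proof -
  \<comment> \<open>The lowest heights are fixed at 0 and removed from the unknowns, while the top
    heights \<open>b p\<close> and \<open>b q\<close> remain; \<open>ext\<close> puts the zeros
    back.\<close>
  define I where "I = Sigma {p, q} (\<lambda>i. coords i - {a i})"
  define D where "D Q i v = (if v = l Q i + s Q then 1 else 0) - (if v = l Q i then 1 else 0 :: int)"
    for Q i v
  define A where "A Q k = (if fst k = p then 1 else - 1) * D Q (fst k) (snd k)" for Q k
  define ext where "ext z i v = (if v = a i then 0 else z (i, v))" for z :: "'d \<times> real \<Rightarrow> real" and i v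
  have finI: "finite I"
    by (simp add: I_def)
  have bI: "(p, b p) \<in> I"
    using box[of p] by (simp add: I_def coords_I)
  have "coords i - {a i} = insert (b i) (inner_coords i)" for i
    using box[of i] by (auto simp: inner_coords_def coords_I)
  then have "card (coords i - {a i}) = Suc (card (inner_coords i))" for i
    by (simp add: inner_coords_def)
  then have cardI: "card I - 1 = card (inner_coords p) + card (inner_coords q) + 1"
    using assms by (simp add: I_def)
  have split: "(\<Sum>k\<in>I. h k) = (\<Sum>v\<in>coords p - {a p}. h (p, v)) + (\<Sum>v\<in>coords q - {a q}. h (q, v))"
    for h :: "'d \<times> real \<Rightarrow> 'b::comm_monoid_add"
  proof -
    have "(\<Sum>k\<in>I. h k) = (\<Sum>i\<in>{p, q}. \<Sum>v\<in>coords i - {a i}. h (i, v))"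
      unfolding I_def by (subst sum.Sigma) auto
    then show ?thesis
      using assms by simp
  qed
  \<comment> \<open>Each direction has at most two nonzero entries, both of absolute value 1; this
    is the source of the base 4.\<close>
  have norm: "(\<Sum>k\<in>I. \<bar>A Q k\<bar>) \<le> int 4" if "Q \<in> T" for Q
  proof -
    have "(\<Sum>v\<in>coords i - {a i}. \<bar>A Q (i, v)\<bar>) \<le> 2" for i
    proof -
      have "(\<Sum>v\<in>coords i - {a i}. \<bar>A Q (i, v)\<bar>) \<le>
          (\<Sum>v\<in>coords i - {a i}. (if v = l Q i + s Q then 1 else 0) + (if v = l Q i then 1 else 0))"
        by (intro sum_mono) (auto simp: A_def D_def)
      also have "\<dots> \<le> 2"
        by (simp add: sum.distrib)
      finally show ?thesis .
    qed
    from this[of p] this[of q] show ?thesis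
      by (simp add: split)
  qed
  have eval: "(\<Sum>k\<in>I. A Q k * z k) = incr (ext z p) p Q - incr (ext z q) q Q" if "Q \<in> T"
    for Q and z :: "'d \<times> real \<Rightarrow> real"
  proof -
    have D: "(\<Sum>v\<in>coords i - {a i}. real_of_int (D Q i v) * z (i, v)) = incr (ext z i) i Q" for i
    proof -
      have pick: "(\<Sum>v\<in>coords i - {a i}. (if v = w then z (i, v) else 0)) = ext z i w"
        if "w \<in> coords i" for w
        using that by (simp add: ext_def)
      have "(\<Sum>v\<in>coords i - {a i}. real_of_int (D Q i v) * z (i, v)) =
          (\<Sum>v\<in>coords i - {a i}. (if v = l Q i + s Q then z (i, v) else 0) -
            (if v = l Q i then z (i, v) else 0))"
        by (intro sum.cong) (auto simp: D_def)
      also have "\<dots> = incr (ext z i) i Q"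
        unfolding sum_subtractf using \<open>Q \<in> T\<close> by (simp only: pick coords_I incr_def)
      finally show ?thesis .
    qed
    show ?thesis
      unfolding split D[symmetric] using assms by (simp add: A_def sum_negf)
  qed
  \<comment> \<open>The actual heights, measured from the lowest hyperplane, solve the system
    because both extents of a cube equal its side.\<close>
  define x where "x k = snd k - a (fst k)" for k :: "'d \<times> real"
  have "ext x i = (\<lambda>v. v - a i)" for i
    by (auto simp: ext_def x_def)
  then have "(\<Sum>k\<in>I. A Q k * x k) = 0" if "Q \<in> T" for Q
    using eval[OF that] by (simp add: incr_def)
  moreover have "x (p, b p) \<noteq> 0"
    using box[of p] by (simp add: x_def)
  ultimately obtain z0 where z0: "\<exists>k\<in>I. z0 k \<noteq> 0"
    "\<forall>k\<in>I. \<bar>z0 k\<bar> \<le> int (4 ^ (card I - 1))" "\<forall>Q\<in>T. (\<Sum>k\<in>I. A Q k * z0 k) = 0"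
    using small_integer_kernel_vector[of T I 4 A "(p, b p)" x] finite_T finI bI norm by auto
  define z where "z k = real_of_int (z0 k)" for k
  define f where "f = ext z p"
  define g where "g = ext z q"
  have fa: "f (a p) = 0" and ga: "g (a q) = 0"
    by (simp_all add: f_def g_def ext_def)
  have fg: "incr f p Q = incr g q Q" if "Q \<in> T" for Q
  proof -
    have "(\<Sum>k\<in>I. A Q k * z k) = real_of_int (\<Sum>k\<in>I. A Q k * z0 k)"
      by (simp add: z_def)
    then show ?thesis
      using z0(3) that eval[OF that, of z] by (simp add: f_def g_def)
  qed
  \<comment> \<open>Subtracting \<open>\<mu>\<close> times the actual heights leaves total change 0
    in direction \<open>p\<close>.\<close>
  define \<mu> where "\<mu> = f (b p) / (b p - a p)"
  define f' where "f' v = f v - \<mu> * (v - a p)" for v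
  define g' where "g' v = g v - \<mu> * (v - a q)" for v
  have incr': "incr f' p Q = incr f p Q - \<mu> * s Q" "incr g' q Q = incr g q Q - \<mu> * s Q" for Q
    by (simp_all add: incr_def f'_def g'_def algebra_simps)
  have "f' (b p) = f' (a p)"
    using box[of p] by (simp add: f'_def \<mu>_def fa)
  \<comment> \<open>The corrected increments in directions \<open>p\<close> and \<open>q\<close>
    agree on every cube, so orthogonality across the two directions makes this vector orthogonal to
    itself.\<close>
  from orthogonal_incr[of p q f', OF assms this, of g']
  have "(\<Sum>Q\<in>T. s Q ^ (CARD('d) - 2) * (incr f' p Q)\<^sup>2) = 0"
    using fg by (simp add: incr' power2_eq_square)
  from weighted_square_eq_0[OF this] have incr_f: "incr f p Q = \<mu> * s Q" if "Q \<in> T" for Q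
    using that by (simp add: incr')
  \<comment> \<open>Otherwise all increments vanish, both height functions are constantly 0 on the
    coordinates, and the integer solution is trivial.\<close>
  have "\<mu> \<noteq> 0"
  proof
    assume "\<mu> = 0"
    then have f0: "f v = 0" if "v \<in> coords p" for v
      using incr_eq_0_imp_const[of f p v] incr_f that fa by simp
    have g0: "g v = 0" if "v \<in> coords q" for v
      using incr_eq_0_imp_const[of g q v] incr_f fg that ga \<open>\<mu> = 0\<close> by simp
    have "z k = 0" if kI: "k \<in> I" for k
    proof -
      obtain i v where k: "k = (i, v)" "i = p \<or> i = q" "v \<in> coords i" "v \<noteq> a i"
        using kI by (auto simp: I_def)
      from k(2) show ?thesis
      proof
        assume "i = p"
        then show ?thesis
          using f0[of v] k by (simp add: f_def ext_def)
      next
        assume "i = q"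
        then show ?thesis
          using g0[of v] k by (simp add: g_def ext_def)
      qed
    qed
    then show False
      using z0(1) by (simp add: z_def)
  qed
  show ?thesis
  \<comment> \<open>The integer solution may have either sign. Up to sign, the scaled side is its
    entry at \<open>b p\<close>, and each scaled cube side is a difference of integer
    heights.\<close>
  proof (intro exI[of _ "\<bar>\<mu>\<bar>"] conjI ballI)
    show "\<bar>\<mu>\<bar> > 0"
      using \<open>\<mu> \<noteq> 0\<close> by simp
    have "\<bar>\<mu>\<bar> * (b p - a p) = \<bar>z (p, b p)\<bar>"
      using box[of p] by (simp add: \<mu>_def f_def ext_def abs_divide)
    also have "\<dots> \<le> 4 ^ (card I - 1)"
    proof -
      have "real_of_int \<bar>z0 (p, b p)\<bar> \<le> real_of_int (int (4 ^ (card I - 1)))"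
        using z0(2) bI unfolding of_int_le_iff by blast
      then show ?thesis
        by (simp add: z_def)
    qed
    finally show "\<bar>\<mu>\<bar> * (b p - a p) \<le> 4 ^ (card (inner_coords p) + card (inner_coords q) + 1)"
      unfolding cardI .
  next
    fix Q assume Q: "Q \<in> T"
    have "\<bar>\<mu>\<bar> * s Q = \<bar>incr f p Q\<bar>"
      using s_pos[OF Q] incr_f[OF Q] by (simp add: abs_mult)
    also have "\<dots> \<in> \<int>"
      by (auto simp: incr_def f_def ext_def z_def)
    finally show "\<bar>\<mu>\<bar> * s Q \<in> \<int>" .
  qed
qed

text \<open>The two directions with the fewest inner hyperplanes carry at most the fraction 2/d of
  all of them, and there are at most \<open>card T - 1\<close> in total.\<close>

lemma integer_scaling:
  assumes "CARD('d) \<ge> 2"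
  shows "\<exists>r>0. \<exists>p. r * (b p - a p) \<le> 4 powr (2 * (real (card T) - 1) / real CARD('d) + 1) \<and>
    (\<forall>Q\<in>T. r * s Q \<in> \<int>)"
proof -
  let ?m = "\<lambda>i. card (inner_coords i)"
  obtain p where p: "\<And>i. ?m p \<le> ?m i"
    using ex_min_if_finite[of "range ?m"] by (auto simp: not_less)
  have "card (UNIV - {p}) \<noteq> 0"
    using assms by simp
  then have "UNIV - {p} \<noteq> {}"
    by (metis card.empty)
  then obtain q where q: "q \<noteq> p" "\<And>i. i \<noteq> p \<Longrightarrow> ?m q \<le> ?m i"
    using ex_min_if_finite[of "?m ` (UNIV - {p})"] by (auto simp: not_less)
  have "?m p + (CARD('d) - 1) * ?m q = ?m p + (\<Sum>i\<in>UNIV - {p}. ?m q)"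
    by simp
  also have "\<dots> \<le> ?m p + (\<Sum>i\<in>UNIV - {p}. ?m i)"
    using q(2) by (intro add_left_mono sum_mono) auto
  also have "\<dots> = (\<Sum>i\<in>UNIV. ?m i)"
    by (simp add: sum.remove[of UNIV p])
  also have "\<dots> + 1 \<le> card T"
    using sum_card_inner_coords_less[OF assms] by simp
  finally have bound: "?m p + (CARD('d) - 1) * ?m q + 1 \<le> card T"
    by simp
  define e where "e = CARD('d) - 2"
  have e: "CARD('d) = e + 2"
    using assms by (simp add: e_def)
  have "CARD('d) * (?m p + ?m q) + 2 = 2 * (?m p + ?m q + 1) + e * ?m p + e * ?m q"
    by (simp add: e algebra_simps)
  \<comment> \<open>Replacing \<open>?m p\<close> by \<open>?m q\<close> in the \<open>e\<close>
    extra terms turns the right side into twice the left side of \<open>bound\<close>.\<close>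
  also have "\<dots> \<le> 2 * (?m p + ?m q + 1) + e * ?m q + e * ?m q"
    using p by (intro add_mono mult_le_mono) auto
  also have "\<dots> = 2 * (?m p + ?m q + e * ?m q + 1)"
    by simp
  also have "\<dots> \<le> 2 * card T"
    using bound by (simp add: e)
  finally have "CARD('d) * (?m p + ?m q) + 2 \<le> 2 * card T" .
  then have "real (CARD('d) * (?m p + ?m q) + 2) \<le> real (2 * card T)"
    by (rule of_nat_mono)
  then have "real (?m p + ?m q) \<le> 2 * (real (card T) - 1) / real CARD('d)"
    by (simp add: pos_le_divide_eq algebra_simps)
  then have "4 powr real (?m p + ?m q + 1) \<le> 4 powr (2 * (real (card T) - 1) / real CARD('d) + 1)"
    by (intro powr_mono) auto
  then have "4 ^ (?m p + ?m q + 1) \<le> 4 powr (2 * (real (card T) - 1) / real CARD('d) + 1)"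
    by (subst (asm) powr_realpow) auto
  then show ?thesis
    using integer_scaling_two_directions[OF q(1)[symmetric]] by (meson order_trans)
qed

text \<open>Volume comparison: the facets of a cube are no larger than the cross-section
  \<open>P\<close> of the box, and its side is at most \<open>b p - a p\<close>, so its volume is at
  most \<open>P * (b p - a p)\<close>.\<close>

lemma side_le_card_mult_side: "b k - a k \<le> real (card T) * (b p - a p)"
proof -
  define P where "P = (\<Prod>i\<in>UNIV - {k}. b i - a i)"
  have s_le: "s Q \<le> b i - a i" if "Q \<in> T" for Q i
    using lower[OF that, of i] upper[OF that, of i] by linarith
  have "P > 0"
    unfolding P_def using box by (intro prod_pos) auto
  have s_power_le: "s Q ^ (CARD('d) - 1) \<le> P" if "Q \<in> T" for Q
  proof -
    have "s Q ^ (CARD('d) - 1) = (\<Prod>i\<in>UNIV - {k}. s Q)"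
      by simp
    also have "\<dots> \<le> P"
      unfolding P_def using s_le[OF that] s_pos[OF that] by (intro prod_mono) (auto intro: less_imp_le)
    finally show ?thesis .
  qed
  have "(b k - a k) * P = (\<Sum>Q\<in>T. s Q ^ (CARD('d) - 1) * s Q)"
    using sum_incr[of "\<lambda>x. x" k] by (simp add: P_def)
  also have "\<dots> \<le> (\<Sum>Q\<in>T. P * (b p - a p))"
    using s_power_le s_le s_pos \<open>P > 0\<close> by (intro sum_mono mult_mono) (auto intro: less_imp_le)
  also have "\<dots> = real (card T) * (b p - a p) * P"
    by simp
  finally show ?thesis
    using \<open>P > 0\<close> by simp
qed

end

section \<open>From sets to coordinates\<close>

lemma eventually_at_right_add_less:
  fixes x y :: real
  assumes "x < y"
  shows "\<forall>\<^sub>F e in at_right 0. x + e < y"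
proof -
  have "\<forall>\<^sub>F e in at_right 0. e \<in> {0<..<y - x}"
    by (rule eventually_at_right_real) (use assms in simp)
  then show ?thesis
    by eventually_elim auto
qed

text \<open>A point belongs to the half-open version of a tile exactly when moving it slightly in
  the direction (1, ..., 1) takes it into the interior of the tile.\<close>

lemma cube_tiling_of_is_tiling:
  fixes a b :: "real ^ 'd" and T :: "(real ^ 'd) set set"
  assumes box: "\<And>i. a $ i < b $ i" and tiling: "is_tiling T (cbox a b)"
    and cube: "\<And>Q. Q \<in> T \<Longrightarrow> 0 < s Q \<and> Q = cbox (l Q) (\<chi> i. l Q $ i + s Q)"
  shows "cube_tiling (\<lambda>i. a $ i) (\<lambda>i. b $ i) T (\<lambda>Q i. l Q $ i) s"
proof
  have fin: "finite T" and disj: "pairwise (\<lambda>P Q. interior P \<inter> interior Q = {}) T"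
    and union: "\<Union>T = cbox a b"
    using tiling by (auto simp: is_tiling_def)
  have mem: "x \<in> Q \<longleftrightarrow> (\<forall>i. l Q $ i \<le> x $ i \<and> x $ i \<le> l Q $ i + s Q)" if "Q \<in> T" for x Q
    by (subst cube[OF that, THEN conjunct2]) (simp add: mem_box_cart)
  have mem_int: "x \<in> interior Q \<longleftrightarrow> (\<forall>i. l Q $ i < x $ i \<and> x $ i < l Q $ i + s Q)"
    if "Q \<in> T" for x Q
    by (subst cube[OF that, THEN conjunct2]) (simp add: interior_cbox mem_box_cart)
  show "finite T"
    by (rule fin)
  show "a $ i < b $ i" for i
    by (rule box)
  show "0 < s Q" if "Q \<in> T" for Q
    using cube[OF that] by simp
  show "a $ i \<le> l Q $ i" if "Q \<in> T" for Q i
  proof -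
    have "l Q \<in> Q"
      using mem[OF that] cube[OF that] by simp
    then have "l Q \<in> cbox a b"
      using that union by blast
    then show ?thesis
      by (simp add: mem_box_cart)
  qed
  show "l Q $ i + s Q \<le> b $ i" if "Q \<in> T" for Q i
  proof -
    have "(\<chi> i. l Q $ i + s Q) \<in> Q"
      using mem[OF that] cube[OF that] by simp
    then have "(\<chi> i. l Q $ i + s Q) \<in> cbox a b"
      using that union by blast
    then show ?thesis
      by (simp add: mem_box_cart)
  qed
  fix c :: "'d \<Rightarrow> real"
  assume c: "\<And>i. a $ i \<le> c i \<and> c i < b $ i"
  define x where "x e = (\<chi> i. c i + e)" for e :: real
  let ?in = "\<lambda>Q. \<forall>i. l Q $ i \<le> c i \<and> c i < l Q $ i + s Q"
  have pos: "\<forall>\<^sub>F e::real in at_right 0. 0 < e"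
    by (rule eventually_at_right_less)
  show "\<exists>!Q. Q \<in> T \<and> ?in Q"
  proof (rule ex_ex1I)
    show "\<exists>Q. Q \<in> T \<and> ?in Q"
    proof (rule ccontr)
      assume no: "\<not> ?thesis"
      \<comment> \<open>Outside the half-open tile some coordinate of \<open>c\<close> is strictly
        below the tile, which small shifts preserve, or at its top or beyond, which any positive
        shift pushes strictly outside.\<close>
      have "\<forall>\<^sub>F e in at_right 0. x e \<notin> Q" if QT: "Q \<in> T" for Q
      proof -
        have outside: "y \<notin> Q" if "y $ i < l Q $ i \<or> l Q $ i + s Q < y $ i" for y i
          using that mem[OF QT, of y] by (meson not_le)
        obtain i where "c i < l Q $ i \<or> l Q $ i + s Q \<le> c i"
          using no QT by (meson not_le)
        then show ?thesis
        proof
          assume "c i < l Q $ i"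
          from eventually_at_right_add_less[OF this] show ?thesis
            by eventually_elim (rule outside[of _ i], simp add: x_def)
        next
          assume le: "l Q $ i + s Q \<le> c i"
          show ?thesis
            using pos by eventually_elim (rule outside[of _ i], use le in \<open>simp add: x_def\<close>)
        qed
      qed
      then have "\<forall>\<^sub>F e in at_right 0. \<forall>Q\<in>T. x e \<notin> Q"
        using fin by (simp add: eventually_ball_finite)
      moreover have "\<forall>\<^sub>F e in at_right 0. \<forall>i. c i + e < b $ i"
        using c by (intro eventually_all_finite eventually_at_right_add_less) auto
      ultimately have "\<forall>\<^sub>F e::real in at_right 0. False"
        using pos
      proof eventually_elim
        case (elim e)
        have "x e \<in> cbox a b"
          using elim c by (auto simp: x_def mem_box_cart intro: add_increasing2 less_imp_le)
        then show False
          using elim union by blast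
      qed
      then show False
        by simp
    qed
  next
    fix P Q assume P: "P \<in> T \<and> ?in P" and Q: "Q \<in> T \<and> ?in Q"
    have inside: "\<forall>\<^sub>F e in at_right 0. x e \<in> interior R" if "R \<in> T \<and> ?in R" for R
    proof -
      have "\<forall>\<^sub>F e in at_right 0. \<forall>i. c i + e < l R $ i + s R"
        using that by (intro eventually_all_finite eventually_at_right_add_less) auto
      with pos show ?thesis
      proof eventually_elim
        case (elim e)
        moreover have "l R $ i < c i + e" for i
          using that elim(1) by (meson less_add_same_cancel1 le_less_trans)
        ultimately show ?case
          using that by (simp add: mem_int x_def)
      qed
    qed
    have "\<forall>\<^sub>F e in at_right 0. x e \<in> interior P \<inter> interior Q"
      using inside[OF P] inside[OF Q] by eventually_elim simp
    from eventually_happens'[OF trivial_limit_at_right_real this]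
    have "interior P \<inter> interior Q \<noteq> {}"
      by blast
    then show "P = Q"
      using disj P Q by (auto simp: pairwise_def)
  qed
qed

section \<open>Scaled boxes and the final bounds\<close>

lemma side_length_scaled_cbox:
  fixes a b :: "real ^ 'd"
  assumes "\<And>i. a $ i \<le> b $ i" "0 \<le> r"
  shows "side_length (scaled r (cbox a b)) i = r * (b $ i - a $ i)"
proof -
  have "cbox a b \<noteq> {}"
    using assms(1) by (simp add: interval_ne_empty_cart)
  then have "scaled r (cbox a b) = cbox (r *\<^sub>R a) (r *\<^sub>R b)"
    using assms(2) by (simp add: scaled_def image_smult_cbox)
  then show ?thesis
    using assms by (simp add: side_length_cbox mult_left_mono right_diff_distrib)
qed

theorem theorem6p1:
  fixes H :: "(real ^ 'd) set" and T :: "(real ^ 'd) set set" and n :: nat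
  assumes "CARD('d) \<ge> 2"
    and "is_hypercuboid H"
    and "is_tiling T H"
    and "\<forall>Q\<in>T. is_hypercube Q"
    and "card T = n"
  shows "\<exists>r::real. r > 0 \<and>
    shortest_side (scaled r H) \<le> 4 powr (2 * (real n - 1) / real CARD('d) + 1) \<and>
    longest_side (scaled r H) \<le> real n * 4 powr (2 * (real n - 1) / real CARD('d) + 1) \<and>
    (\<forall>Q\<in>T. \<forall>i. side_length (scaled r Q) i \<in> \<int>)"
proof -
  let ?B = "4 powr (2 * (real n - 1) / real CARD('d) + 1)"
  obtain a b where H: "\<And>i. a $ i < b $ i" "H = cbox a b"
    using assms(2) by (auto simp: is_hypercuboid_def)
  obtain l s where ls: "\<And>Q. Q \<in> T \<Longrightarrow> 0 < s Q \<and> Q = cbox (l Q) (\<chi> i. l Q $ i + s Q)"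
    using assms(4) unfolding is_hypercube_def by metis
  interpret cube_tiling "\<lambda>i. a $ i" "\<lambda>i. b $ i" T "\<lambda>Q i. l Q $ i" s
    using H ls assms(3) by (intro cube_tiling_of_is_tiling) auto
  obtain r p where r: "r > 0" "r * (b $ p - a $ p) \<le> ?B" "\<And>Q. Q \<in> T \<Longrightarrow> r * s Q \<in> \<int>"
    using integer_scaling[OF assms(1)] assms(5) by blast
  have side: "side_length (scaled r H) i = r * (b $ i - a $ i)" for i
    using H r(1) by (simp add: side_length_scaled_cbox less_imp_le)
  \<comment> \<open>The bound is known for direction \<open>p\<close> only: the shortest side is no
    longer than that one, and every side is at most \<open>n\<close> times it.\<close>
  have "shortest_side (scaled r H) \<le> side_length (scaled r H) p"
    unfolding shortest_side_def by (intro Min_le) auto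
  then have "shortest_side (scaled r H) \<le> ?B"
    using r(2) by (simp add: side)
  moreover have "longest_side (scaled r H) \<le> real n * ?B"
    unfolding longest_side_def
  proof (subst Max_le_iff)
    show "\<forall>y\<in>range (side_length (scaled r H)). y \<le> real n * ?B"
    proof clarify
      fix k
      have "r * (b $ k - a $ k) \<le> r * (real n * (b $ p - a $ p))"
        using side_le_card_mult_side[of k p] assms(5) r(1) by (intro mult_left_mono) auto
      also have "\<dots> = real n * (r * (b $ p - a $ p))"
        by simp
      also have "\<dots> \<le> real n * ?B"
        using r(2) by (intro mult_left_mono) auto
      finally show "side_length (scaled r H) k \<le> real n * ?B"
        by (simp add: side)
    qed
  qed auto
  moreover have "side_length (scaled r Q) i \<in> \<int>" if "Q \<in> T" for Q i
  proof -
    have "side_length (scaled r Q) i = r * s Q"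
      using ls[OF that] r(1)
      by (metis (mono_tags, lifting) add_diff_cancel_left' less_add_same_cancel1 less_imp_le
          side_length_scaled_cbox vec_lambda_beta)
    then show ?thesis
      using r(3)[OF that] by simp
  qed
  ultimately show ?thesis
    using r(1) by blast
qed

end
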